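(* Let $m$ be a nonzero integer that is neither a unit nor a prime, $\mathbb{Z}_m=\mathbb{Z}/m\mathbb{Z}$, $X$ a finite alphabet and $\mathcal{P}_m=\mathbb{Z}_m\langle X\rangle$ with a fixed monomial well-ordering. Let $\mathcal{J}$ be a two-sided ideal of $\mathcal{P}_m$ and let $a,b,r,s\in\mathbb{Z}_m$ be such that $ab=0$ and $a,b$ are coprime with $ar+bs=1$. Let $\mathcal{G}_a=\{g_{a,i}\}_i$ and $\mathcal{G}_b=\{g_{b,j}\}_j$ be strong Gröbner bases for $\mathcal{J}+a\mathcal{P}_m$ and $\mathcal{J}+b\mathcal{P}_m$ respectively, such that for every $g_{a,i}\in\mathcal{G}_a\setminus\mathbb{Z}_m$ we have $a\nmid\mathrm{lc}(g_{a,i})$ and $\mathrm{lc}(g_{a,i})\mid a$, and for every $g_{b,j}\in\mathcal{G}_b\setminus\mathbb{Z}_m$ we have $b\nmid\mathrm{lc}(g_{b,j})$ and $\mathrm{lc}(g_{b,j})\mid b$. For $g_{a,i}\in\mathcal{G}_a$, $g_{b,j}\in\mathcal{G}_b$ and every overlap relation $\tau_{i,j}\,\mathrm{lm}(g_{a,i})=\tau_{j,i}\,\mathrm{lm}(g_{b,j})$ (as specified in the context) define $$f_{i,j}:=ar\,\mathrm{lc}(g_{a,i})\,\tau_{j,i}\,g_{b,j}+bs\,\mathrm{lc}(g_{b,j})\,\tau_{i,j}\,g_{a,i},$$ and assume $\mathrm{lc}(g_{a,i})\,\mathrm{lc}(g_{b,j})\neq0$ for all $i,j$. Then $\mathcal{G}:=\{f_{i,j}\}_{i,j}$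 is a strong Gröbner basis for $\mathcal{J}$.
   Context: **Notation.** $\mathcal{B}=\langle X\rangle$ is the free monoid of words (monomials), a $\mathbb{Z}_m$-basis of $\mathcal{P}_m$. $\mathcal{B}^e=\{u\otimes v:u,v\in\mathcal{B}\}$ is the basis of $\mathcal{P}_m\otimes_{\mathbb{Z}_m}\mathcal{P}_m^{\mathrm{opp}}$, acting by $(u\otimes v)\cdot t=utv$. $\mathrm{lm},\mathrm{lc},\mathrm{lt}=\mathrm{lc}\cdot\mathrm{lm}$ denote leading monomial, coefficient and term. A word $u$ divides $v$ if $v=\tau\cdot u$ for some $\tau\in\mathcal{B}^e$; a term $c\,u$ divides a term $c'v$ if $c\mid c'$ in $\mathbb{Z}_m$ and $u$ divides $v$. **Strong Gröbner basis.** For $\mathcal{S}\subseteq\mathcal{P}_m$ let $\mathrm{L}(\mathcal{S})=\langle\mathrm{lt}(f):f\in\mathcal{S}\setminus\{0\}\rangle$ (two-sided ideal). A countable set $\mathcal{G}\subseteq\mathcal{I}\setminus\{0\}$ is a strong Gröbner basis for a two-sided ideal $\mathcal{I}$ if $\mathrm{L}(\mathcal{I})\subseteq\mathrm{L}(\mathcal{G})$ and for every $f'\in\mathcal{I}\setminus\{0\}$ there is $g'\in\mathcal{G}$ with $\mathrm{lt}(g')$ dividing $\mathrm{lt}(f')$. **Overlap relations.** For a pair $(i,j)$ one considers all $\tau_{i,j},\tau_{j,i}\in\mathcal{B}^e$ with $\tau_{i,j}\,\mathrm{lm}(g_{a,i})=\tau_{j,i}\,\mathrm{lm}(g_{b,j})$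 such that, for suitable words $x,x',y,y'\in\mathcal{B}$, one of the four cases holds: (i) $\tau_{i,j}=1\otimes x'$, $\tau_{j,i}=y\otimes1$; (ii) $\tau_{i,j}=x\otimes1$, $\tau_{j,i}=1\otimes y'$; (iii) $\tau_{i,j}=1\otimes1$, $\tau_{j,i}=y\otimes y'$; (iv) $\tau_{i,j}=x\otimes x'$, $\tau_{j,i}=1\otimes1$. These are not unique; $\mathcal{G}$ contains an element $f_{i,j}$ for each pair $(i,j)$ and each such overlap relation (including those where the two leading monomials are merely placed next to each other, possibly with a word in between). *)

theory Defs
  imports
    "HOL-Library.Poly_Mapping"
    "HOL-Library.Countable_Set"
    "Berlekamp_Zassenhaus.Finite_Field"
begin

text \<open>Words over \<^typ>\<open>'x\<close> form the free monoid under concatenation. The monoid is written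
  additively because the convolution product of \<^type>\<open>poly_mapping\<close> requires an additive
  monoid of exponents; so \<open>0\<close> is the empty word and \<open>u + v = u @ v\<close> (not commutative).\<close>

instantiation list :: (type) monoid_add
begin

definition zero_list :: "'a list" where "zero_list = []"

definition plus_list :: "'a list \<Rightarrow> 'a list \<Rightarrow> 'a list" where "plus_list u v = u @ v"

instance
  by standard (simp_all add: zero_list_def plus_list_def)

end

text \<open>The free associative algebra: finitely supported functions from words to coefficients,
  with \<open>Poly_Mapping.single w c\<close> the term \<open>c w\<close>.\<close>

type_synonym ('x, 'c) free_algebra = "'x list \<Rightarrow>\<^sub>0 'c"

definition const :: "'c \<Rightarrow> ('x, 'c::comm_ring_1) free_algebra" where
  "const c = Poly_Mapping.single [] c"

text \<open>A pair \<open>(u, v)\<close> represents the basis element \<open>u \<otimes> v\<close> of the enveloping algebra; it acts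
  on words and, linearly, on polynomials by \<open>t \<mapsto> u t v\<close>.\<close>

type_synonym 'x bimon = "'x list \<times> 'x list"

definition act_word :: "'x bimon \<Rightarrow> 'x list \<Rightarrow> 'x list" where
  "act_word \<tau> w = fst \<tau> @ w @ snd \<tau>"

definition act :: "'x bimon \<Rightarrow> ('x, 'c::comm_ring_1) free_algebra \<Rightarrow> ('x, 'c) free_algebra" where
  "act \<tau> f = Poly_Mapping.single (fst \<tau>) 1 * f * Poly_Mapping.single (snd \<tau>) 1"

definition word_dvd :: "'x list \<Rightarrow> 'x list \<Rightarrow> bool" where
  "word_dvd u v \<longleftrightarrow> (\<exists>\<tau>. v = act_word \<tau> u)"

text \<open>Divisibility of (nonzero) terms. The coefficients are required to be nonzero so that the
  term determines both its coefficient and its word.\<close>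

definition term_dvd ::
  "('x, 'c::comm_ring_1) free_algebra \<Rightarrow> ('x, 'c) free_algebra \<Rightarrow> bool" where
  "term_dvd p q \<longleftrightarrow> (\<exists>c u c' v. c \<noteq> 0 \<and> c' \<noteq> 0 \<and>
     p = Poly_Mapping.single u c \<and> q = Poly_Mapping.single v c' \<and> c dvd c' \<and> word_dvd u v)"

definition monomial_well_order :: "('x list \<times> 'x list) set \<Rightarrow> bool" where
  "monomial_well_order r \<longleftrightarrow> well_order r \<and>
     (\<forall>u v p q. (u, v) \<in> r \<longrightarrow> (p @ u @ q, p @ v @ q) \<in> r)"

text \<open>Leading data with respect to \<open>r\<close>, where \<open>(u, v) \<in> r\<close> means \<open>u \<le> v\<close>;
  only meaningful for nonzero \<open>f\<close>.\<close>

definition lm :: "('x list \<times> 'x list) set \<Rightarrow> ('x, 'c::comm_ring_1) free_algebra \<Rightarrow> 'x list" where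
  "lm r f = (THE u. u \<in> Poly_Mapping.keys f \<and> (\<forall>v \<in> Poly_Mapping.keys f. (v, u) \<in> r))"

definition lc :: "('x list \<times> 'x list) set \<Rightarrow> ('x, 'c::comm_ring_1) free_algebra \<Rightarrow> 'c" where
  "lc r f = Poly_Mapping.lookup f (lm r f)"

definition lt ::
  "('x list \<times> 'x list) set \<Rightarrow> ('x, 'c::comm_ring_1) free_algebra \<Rightarrow> ('x, 'c) free_algebra" where
  "lt r f = Poly_Mapping.single (lm r f) (lc r f)"

definition two_sided_ideal :: "'r::ring_1 set \<Rightarrow> bool" where
  "two_sided_ideal I \<longleftrightarrow> 0 \<in> I \<and> (\<forall>x\<in>I. \<forall>y\<in>I. x + y \<in> I) \<and> (\<forall>x\<in>I. \<forall>p q. p * x * q \<in> I)"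

definition leading_ideal ::
  "('x list \<times> 'x list) set \<Rightarrow> ('x, 'c::comm_ring_1) free_algebra set
     \<Rightarrow> ('x, 'c) free_algebra set" where
  "leading_ideal r S = two_sided_ideal hull (lt r ` (S - {0}))"

definition strong_groebner_basis ::
  "('x list \<times> 'x list) set \<Rightarrow> ('x, 'c::comm_ring_1) free_algebra set
     \<Rightarrow> ('x, 'c) free_algebra set \<Rightarrow> bool" where
  "strong_groebner_basis r G I \<longleftrightarrow>
     countable G \<and> G \<subseteq> I - {0} \<and> leading_ideal r I \<subseteq> leading_ideal r G \<and>
     (\<forall>f \<in> I - {0}. \<exists>g \<in> G. term_dvd (lt r g) (lt r f))"

text \<open>The ideal \<open>J + a P\<close>, where \<open>P\<close> is the whole algebra.\<close>

definition ideal_plus ::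
  "('x, 'c::comm_ring_1) free_algebra set \<Rightarrow> 'c \<Rightarrow> ('x, 'c) free_algebra set" where
  "ideal_plus J a = {j + const a * p | j p. j \<in> J}"

text \<open>\<open>overlap u v \<tau> \<tau>'\<close>: the relation \<open>\<tau> u = \<tau>' v\<close> is an overlap relation. In the first two cases
  the cofactors are arbitrary, so \<open>u\<close> and \<open>v\<close> may also be disjoint in the common multiple, with
  any word in between.\<close>

definition overlap :: "'x list \<Rightarrow> 'x list \<Rightarrow> 'x bimon \<Rightarrow> 'x bimon \<Rightarrow> bool" where
  "overlap u v \<tau> \<tau>' \<longleftrightarrow> act_word \<tau> u = act_word \<tau>' v \<and>
     ((\<exists>x' y. \<tau> = ([], x') \<and> \<tau>' = (y, [])) \<or>
      (\<exists>x y'. \<tau> = (x, []) \<and> \<tau>' = ([], y')) \<or>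
      (\<exists>y y'. \<tau> = ([], []) \<and> \<tau>' = (y, y')) \<or>
      (\<exists>x x'. \<tau> = (x, x') \<and> \<tau>' = ([], [])))"

end

theory Submission
  imports Defs
begin

text \<open>The combination \<open>f\<^sub>i\<^sub>j\<close> is built like a Chinese remainder lift. It lies in \<open>J\<close>: the
  factor \<open>a\<close> in front of an element of \<open>J + b P\<close> kills the \<open>b P\<close> part because \<open>a b = 0\<close>, and
  symmetrically with \<open>a\<close> and \<open>b\<close> exchanged (\<open>annihilator_mult_ideal_plus\<close>). No word
  of either summand exceeds the common multiple \<open>w\<close> of the two leading words, and the coefficient
  of \<open>w\<close> in the sum is \<open>(a \<rho> + b \<sigma>) lc(g) lc(h) = lc(g) lc(h)\<close>. It does not vanish, so it is the leading
  coefficient (\<open>leading_data_combination\<close>).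

  For the divisibility property let \<open>f\<close> be a nonzero element of \<open>J\<close>. It lies in both larger
  ideals, so \<open>lt(g)\<close> and \<open>lt(h)\<close> divide \<open>lt(f)\<close> for some \<open>g\<close> and \<open>h\<close> in the given
  bases. Two subwords of one word always sit in it as one of the four overlap types
  (\<open>overlap_of_common_multiple\<close>), so the words are fine. For the coefficients one wants
  \<open>lc(g)\<close> to divide \<open>a\<close> and \<open>lc(h)\<close> to divide \<open>b\<close>: then they are comaximal, and
  their product divides \<open>lc(f)\<close> as soon as each of them does.

  The assumptions give this only for nonconstant basis elements. A constant \<open>c\<close> in the basis may
  fail to divide \<open>a\<close>, but then it can be replaced: \<open>gcd(a, c)\<close> is again a constant in
  \<open>J + a P\<close>, since it is a linear combination of \<open>a\<close> and \<open>c\<close>, so some basis element has the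
  empty leading word and a leading coefficient dividing the gcd, hence both \<open>a\<close> and \<open>lc(f)\<close>
  (\<open>exists_divisor_with_lc_dvd\<close>). The inclusion of leading ideals is a formal consequence of
  divisibility (\<open>strong_groebner_basisI\<close>).\<close>

section \<open>Coefficients\<close>

text \<open>Representatives reduce this to the integers: a Bezout identity for representatives maps to one
  in the quotient. The element \<open>d\<close> is a gcd that lies in the ideal generated by \<open>a\<close> and \<open>c\<close>.\<close>

lemma bezout_mod_ring:
  fixes a c :: "'n::nontriv mod_ring"
  obtains d x y where "d = a * x + c * y" "d dvd a" "d dvd c"
proof -
  have lift: "of_int (to_int_mod_ring z) = z" for z :: "'n mod_ring"
    by (metis of_int_of_int_mod_ring of_int_mod_ring_to_int_mod_ring)
  define k l where "k = to_int_mod_ring a" and "l = to_int_mod_ring c"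
  have a: "a = of_int k" and c: "c = of_int l" by (simp_all add: k_def l_def lift)
  obtain x y where xy: "x * k + y * l = gcd k l" using bezout_int by blast
  show ?thesis
  proof
    show "(of_int (gcd k l) :: 'n mod_ring) = a * of_int x + c * of_int y"
      unfolding a c of_int_mult[symmetric] of_int_add[symmetric] using xy
      by (simp add: mult.commute)
    have "(of_int (gcd k l) :: 'n mod_ring) dvd of_int z" if "gcd k l dvd z" for z
      using that by (auto elim!: dvdE)
    then show "(of_int (gcd k l) :: 'n mod_ring) dvd a" "(of_int (gcd k l) :: 'n mod_ring) dvd c"
      by (simp_all add: a c)
  qed
qed

text \<open>The usual argument for coprime divisors, in a ring that may have zero divisors: writing
  \<open>e = e a \<rho> + e b \<sigma>\<close>, the first summand has the factor \<open>d\<close> from \<open>e\<close> and \<open>c\<close> from \<open>a\<close>, the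
  second \<open>c\<close> from \<open>e\<close> and \<open>d\<close> from \<open>b\<close>.\<close>

lemma mult_dvd_of_divides_comaximal:
  fixes c d e :: "'c::comm_ring_1"
  assumes "c dvd a" "d dvd b" "a * \<rho> + b * \<sigma> = 1" "c dvd e" "d dvd e"
  shows "c * d dvd e"
proof -
  obtain x where a: "a = c * x" using assms(1) ..
  obtain y where b: "b = d * y" using assms(2) ..
  obtain p where p: "e = c * p" using assms(4) ..
  obtain q where q: "e = d * q" using assms(5) ..
  have "e = e * (c * x * \<rho>) + e * (d * y * \<sigma>)"
    using assms(3) unfolding a b by (metis distrib_left mult.right_neutral)
  also have "\<dots> = d * q * (c * x * \<rho>) + c * p * (d * y * \<sigma>)"
    using p q by metis
  also have "\<dots> = (c * d) * (q * x * \<rho> + p * y * \<sigma>)" by (simp add: algebra_simps)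
  finally show ?thesis by (metis dvd_triv_left)
qed

section \<open>Constants and the bimodule action\<close>

text \<open>Additive identities about polynomials need to be checked only on single terms.\<close>

lemma poly_mapping_induct [case_names single sum]:
  fixes f :: "'a \<Rightarrow>\<^sub>0 'b::monoid_add"
  assumes single: "\<And>k v. P (Poly_Mapping.single k v)"
    and sum: "\<And>f g. P f \<Longrightarrow> P g \<Longrightarrow> P (f + g)"
  shows "P f"
proof (induction f rule: Poly_Mapping.update_induct)
  case const
  show ?case using single[of undefined 0] by simp
next
  case (update f k v)
  have "Poly_Mapping.update k v f = Poly_Mapping.single k v + f"
    using update.hyps(1)
    by (intro poly_mapping_eqI)
      (auto simp: lookup_update lookup_add lookup_single when_def in_keys_iff)
  then show ?case using sum[OF single update.IH] by simp
qed

lemma const_mult_commute: "const c * f = f * const c"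
proof (induction f rule: poly_mapping_induct)
  case (single k v)
  show ?case
    by (simp add: const_def mult_single plus_list_def mult.commute)
next
  case (sum f g)
  then show ?case by (simp add: algebra_simps)
qed

lemma const_mult: "const c * const d = const (c * d)"
  by (simp add: const_def mult_single plus_list_def)

lemma lookup_const_mult: "Poly_Mapping.lookup (const c * f) w = c * Poly_Mapping.lookup f w"
proof (induction f rule: poly_mapping_induct)
  case (single k v)
  show ?case
    by (simp add: const_def mult_single plus_list_def lookup_single when_def)
next
  case (sum f g)
  then show ?case by (simp add: algebra_simps lookup_add)
qed

lemma act_add: "act \<tau> (f + g) = act \<tau> f + act \<tau> g"
  by (simp add: act_def algebra_simps)

lemma act_const_mult: "act \<tau> (const c * f) = const c * act \<tau> f"
  by (simp only: act_def mult.assoc[symmetric]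
      const_mult_commute[of c "Poly_Mapping.single (fst \<tau>) 1"])

lemma act_single: "act \<tau> (Poly_Mapping.single w c) = Poly_Mapping.single (act_word \<tau> w) c"
  by (simp add: act_def act_word_def mult_single plus_list_def)

lemma inj_act_word: "act_word \<tau> u = act_word \<tau> v \<longleftrightarrow> u = v"
  by (auto simp: act_word_def)

text \<open>Multiplication by words on the two sides moves coefficients without merging them, because
  the free monoid is cancellative.\<close>

lemma lookup_act: "Poly_Mapping.lookup (act \<tau> f) (act_word \<tau> w) = Poly_Mapping.lookup f w"
proof (induction f rule: poly_mapping_induct)
  case (single k v)
  show ?case by (simp add: act_single lookup_single inj_act_word)
next
  case (sum f g)
  then show ?case by (simp add: act_add lookup_add)
qed

lemma lookup_act_outside:
  "v \<notin> range (act_word \<tau>) \<Longrightarrow> Poly_Mapping.lookup (act \<tau> f) v = 0"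
proof (induction f rule: poly_mapping_induct)
  case (single k c)
  then show ?case by (auto simp: act_single lookup_single when_def)
next
  case (sum f g)
  then show ?case by (simp add: act_add lookup_add)
qed

lemma keys_act: "Poly_Mapping.keys (act \<tau> f) = act_word \<tau> ` Poly_Mapping.keys f"
proof -
  have "v \<in> act_word \<tau> ` Poly_Mapping.keys f" if "v \<in> Poly_Mapping.keys (act \<tau> f)" for v
  proof -
    obtain w where "v = act_word \<tau> w"
      using \<open>v \<in> _\<close> lookup_act_outside by (fastforce simp: in_keys_iff)
    then show ?thesis using \<open>v \<in> _\<close> by (simp add: in_keys_iff lookup_act)
  qed
  then show ?thesis by (auto simp: in_keys_iff lookup_act)
qed

section \<open>Leading data\<close>

lemma lm_eqI:
  assumes "monomial_well_order r" "u \<in> Poly_Mapping.keys f"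
    and "\<And>v. v \<in> Poly_Mapping.keys f \<Longrightarrow> (v, u) \<in> r"
  shows "lm r f = u"
proof -
  have "antisym r"
    using assms(1)
    by (auto simp: monomial_well_order_def well_order_on_def linear_order_on_def
        partial_order_on_def)
  then show ?thesis
    unfolding lm_def using assms(2,3) by (blast intro: the_equality dest: antisymD)
qed

lemma lm_greatest:
  assumes "monomial_well_order r" "f \<noteq> 0"
  shows lm_in_keys: "lm r f \<in> Poly_Mapping.keys f"
    and keys_le_lm: "v \<in> Poly_Mapping.keys f \<Longrightarrow> (v, lm r f) \<in> r"
proof -
  have lin: "linear_order r"
    using assms(1) by (simp add: monomial_well_order_def well_order_on_def)
  then have tr: "trans r" and tot: "(v, w) \<in> r \<or> (w, v) \<in> r" for v w
    unfolding linear_order_on_def partial_order_on_def preorder_on_def total_on_def refl_on_def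
    by (blast, metis UNIV_I)
  have max: "\<exists>u\<in>A. \<forall>v\<in>A. (v, u) \<in> r" if "finite A" "A \<noteq> {}" for A
    using that
  proof (induction rule: finite_ne_induct)
    case (singleton x)
    show ?case using tot[of x x] by simp
  next
    case (insert x F)
    then obtain u where u: "u \<in> F" "\<And>v. v \<in> F \<Longrightarrow> (v, u) \<in> r" by blast
    show ?case
    proof (cases "(x, u) \<in> r")
      case True
      with u show ?thesis by blast
    next
      case False
      then have "(u, x) \<in> r" using tot by blast
      with u(2) tot[of x x] show ?thesis by (blast intro: transD[OF tr])
    qed
  qed
  obtain u where u: "u \<in> Poly_Mapping.keys f" "\<And>v. v \<in> Poly_Mapping.keys f \<Longrightarrow> (v, u) \<in> r"
    using max[of "Poly_Mapping.keys f"] assms(2) by auto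
  then have "lm r f = u" by (rule lm_eqI[OF assms(1)])
  with u show "lm r f \<in> Poly_Mapping.keys f"
    and "v \<in> Poly_Mapping.keys f \<Longrightarrow> (v, lm r f) \<in> r" by simp_all
qed

lemma lc_nonzero:
  assumes "monomial_well_order r" "f \<noteq> 0"
  shows "lc r f \<noteq> 0"
  using lm_in_keys[OF assms] by (simp add: lc_def in_keys_iff)

lemma const_eq_0_iff: "const c = 0 \<longleftrightarrow> c = 0"
  by (metis const_def lookup_single_eq lookup_zero single_zero)

lemma lm_const:
  assumes "monomial_well_order r" "c \<noteq> 0"
  shows "lm r (const c) = []"
  using lm_in_keys[OF assms(1), of "const c"] assms(2)
  by (auto simp: const_eq_0_iff) (simp add: const_def)

lemma lc_const:
  assumes "monomial_well_order r" "c \<noteq> 0"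
  shows "lc r (const c) = c"
  unfolding lc_def lm_const[OF assms] by (simp add: const_def)

text \<open>Both leading coefficients are nonzero, so the terms determine their coefficients and words.\<close>

lemma term_dvd_lt_iff:
  assumes "monomial_well_order r" "f \<noteq> 0" "g \<noteq> 0"
  shows "term_dvd (lt r g) (lt r f) \<longleftrightarrow> lc r g dvd lc r f \<and> word_dvd (lm r g) (lm r f)"
proof -
  have "lc r f \<noteq> 0" "lc r g \<noteq> 0" by (rule lc_nonzero[OF assms(1)], fact)+
  moreover have "Poly_Mapping.single u c = Poly_Mapping.single v d \<longleftrightarrow> u = v \<and> c = d"
    if "c \<noteq> 0" for u v :: "'a list" and c d :: 'b
    using that by (metis keys_single lookup_single_eq singleton_inject insert_not_empty)
  ultimately show ?thesis unfolding term_dvd_def lt_def by metis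
qed

text \<open>The order is compatible with multiplication, so no word of either summand exceeds the common
  multiple. The hypothesis on the coefficient there rules out cancellation.\<close>

lemma leading_data_combination:
  assumes r: "monomial_well_order r" and nz: "g \<noteq> 0" "h \<noteq> 0"
    and w: "act_word \<tau> (lm r g) = act_word \<tau>' (lm r h)"
    and c: "d * lc r h + e * lc r g \<noteq> 0"
  defines "f \<equiv> const d * act \<tau>' h + const e * act \<tau> g"
  shows "lm r f = act_word \<tau> (lm r g)" and "lc r f = d * lc r h + e * lc r g" and "f \<noteq> 0"
proof -
  let ?w = "act_word \<tau> (lm r g)"
  have coeff: "Poly_Mapping.lookup f ?w = d * lc r h + e * lc r g"
    unfolding f_def lookup_add lookup_const_mult lookup_act using w
    by (simp add: lookup_act lc_def)
  have le: "(act_word \<tau> v, act_word \<tau> (lm r p)) \<in> r"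
    if "p \<noteq> 0" "v \<in> Poly_Mapping.keys p" for \<tau> v p
    using r keys_le_lm[OF r that] by (auto simp: monomial_well_order_def act_word_def)
  have "(v, ?w) \<in> r" if "v \<in> Poly_Mapping.keys f" for v
  proof -
    have "v \<in> Poly_Mapping.keys (act \<tau>' h) \<or> v \<in> Poly_Mapping.keys (act \<tau> g)"
      using that by (auto simp: f_def in_keys_iff lookup_add lookup_const_mult)
    then show ?thesis using le[OF nz(1), of _ \<tau>] le[OF nz(2), of _ \<tau>'] w by (auto simp: keys_act)
  qed
  then show lm: "lm r f = ?w" using coeff c by (intro lm_eqI[OF r]) (simp_all add: in_keys_iff)
  show "lc r f = d * lc r h + e * lc r g" unfolding lc_def[of r f] lm coeff ..
  show "f \<noteq> 0" using coeff c by auto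
qed

section \<open>Common multiples of words\<close>

text \<open>Fix an occurrence of \<open>u\<close> and one of \<open>v\<close> in \<open>w\<close> and compare which starts first and which ends
  last. The four answers are the four overlap types; the least stretch of \<open>w\<close> that covers both
  occurrences is the common multiple.\<close>

lemma overlap_of_common_multiple:
  assumes "word_dvd u w" "word_dvd v w"
  obtains \<tau> \<tau>' where "overlap u v \<tau> \<tau>'" "word_dvd (act_word \<tau> u) w"
proof -
  obtain p q where pq: "w = p @ u @ q" using assms(1) by (auto simp: word_dvd_def act_word_def)
  obtain s t where st: "w = s @ v @ t" using assms(2) by (auto simp: word_dvd_def act_word_def)
  have split: "(\<exists>z. p' = s' @ z) \<or> (\<exists>z. s' = p' @ z)" if "p' @ q' = s' @ t'" for p' q' s' t' :: "'a list"
    using that by (auto simp: append_eq_append_conv2)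
  have split': "(\<exists>z. q' = z @ t') \<or> (\<exists>z. t' = z @ q')" if "p' @ q' = s' @ t'" for p' q' s' t' :: "'a list"
    using that by (auto simp: append_eq_append_conv2)
  have starts: "(\<exists>z. p = s @ z) \<or> (\<exists>z. s = p @ z)"
    using split[of p "u @ q" s "v @ t"] pq st by simp
  have ends: "(\<exists>z. q = z @ t) \<or> (\<exists>z. t = z @ q)"
    using split'[of "p @ u" q "s @ v" t] pq st by simp
  have div: "word_dvd x w" if "w = y @ x @ z" for x y z
    using that by (auto simp: word_dvd_def act_word_def intro!: exI[of _ "(y, z)"])
  \<comment> \<open>In order: \<open>u\<close> inside \<open>v\<close>, \<open>v\<close> first, \<open>u\<close> first, \<open>v\<close> inside \<open>u\<close>.\<close>
  from starts ends show ?thesis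
  proof (elim disjE exE)
    fix x z assume x: "p = s @ x" and z: "q = z @ t"
    show ?thesis
      by (rule that[of "(x, z)" "([], [])"]; (rule div[of s _ t])?;
          use pq st x z in \<open>auto simp: overlap_def act_word_def\<close>)
  next
    fix x z assume x: "p = s @ x" and z: "t = z @ q"
    show ?thesis
      by (rule that[of "(x, [])" "([], z)"]; (rule div[of s _ q])?;
          use pq st x z in \<open>auto simp: overlap_def act_word_def\<close>)
  next
    fix y z assume x: "s = p @ y" and z: "q = z @ t"
    show ?thesis
      by (rule that[of "([], z)" "(y, [])"]; (rule div[of p _ t])?;
          use pq st x z in \<open>auto simp: overlap_def act_word_def\<close>)
  next
    fix y z assume x: "s = p @ y" and z: "t = z @ q"
    show ?thesis
      by (rule that[of "([], [])" "(y, z)"]; (rule div[of p _ q])?;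
          use pq st x z in \<open>auto simp: overlap_def act_word_def\<close>)
  qed
qed

section \<open>Ideals\<close>

lemma ideal_act_const:
  assumes "two_sided_ideal I" "f \<in> I"
  shows "const c * act \<tau> f \<in> I"
proof -
  have "const c * act \<tau> f =
      (const c * Poly_Mapping.single (fst \<tau>) 1) * f * Poly_Mapping.single (snd \<tau>) 1"
    by (simp add: act_def mult.assoc)
  then show ?thesis using assms by (simp add: two_sided_ideal_def)
qed

text \<open>Constants are central, so \<open>d\<close> meets the factor \<open>a\<close> of the \<open>a P\<close> part and kills it.\<close>

lemma annihilator_mult_ideal_plus:
  assumes J: "two_sided_ideal J" and "f \<in> ideal_plus J a" "d * a = 0"
  shows "const d * act \<tau> f \<in> J"
proof -
  obtain j p where "j \<in> J" and f: "f = j + const a * p" using assms(2) by (auto simp: ideal_plus_def)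
  have "const d * act \<tau> f = const d * act \<tau> j + (const d * const a) * act \<tau> p"
    by (simp add: f act_add act_const_mult algebra_simps)
  also have "const d * const a = 0" using assms(3) by (simp add: const_mult) (simp add: const_def)
  finally show ?thesis using ideal_act_const[OF J \<open>j \<in> J\<close>] by simp
qed

lemma subset_ideal_plus: "J \<subseteq> ideal_plus J a"
proof
  fix j assume "j \<in> J"
  moreover have "j = j + const a * 0" by simp
  ultimately show "j \<in> ideal_plus J a" unfolding ideal_plus_def by blast
qed

lemma two_sided_ideal_hull: "two_sided_ideal (two_sided_ideal hull (S :: 'a::ring_1 set))"
proof (rule hull_in)
  fix T :: "'a set set" assume "Ball T two_sided_ideal"
  then have T: "two_sided_ideal I" if "I \<in> T" for I using that by blast
  show "two_sided_ideal (\<Inter>T)"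
    unfolding two_sided_ideal_def
  proof (intro conjI ballI allI InterI)
    fix I assume "I \<in> T"
    then show "0 \<in> I" using T by (simp add: two_sided_ideal_def)
    fix x assume "x \<in> \<Inter>T"
    then have x: "x \<in> I" using \<open>I \<in> T\<close> by blast
    then show "p * x * q \<in> I" for p q
      using T[OF \<open>I \<in> T\<close>] by (simp add: two_sided_ideal_def)
    fix y assume "y \<in> \<Inter>T"
    then have "y \<in> I" using \<open>I \<in> T\<close> by blast
    then show "x + y \<in> I" using x T[OF \<open>I \<in> T\<close>] by (simp add: two_sided_ideal_def)
  qed
qed

text \<open>If \<open>lt(g)\<close> divides \<open>lt(f)\<close>, then \<open>lt(f)\<close> is a two-sided multiple of \<open>lt(g)\<close>. So the
  divisibility condition already implies the inclusion of leading ideals.\<close>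

lemma strong_groebner_basisI:
  assumes r: "monomial_well_order r" and "countable G" "G \<subseteq> I - {0}"
    and div: "\<And>f. f \<in> I - {0} \<Longrightarrow> \<exists>g\<in>G. lc r g dvd lc r f \<and> word_dvd (lm r g) (lm r f)"
  shows "strong_groebner_basis r G I"
proof -
  have "lt r f \<in> leading_ideal r G" if f: "f \<in> I - {0}" for f
  proof -
    obtain g k \<tau> where g: "g \<in> G" "lc r f = lc r g * k" "lm r f = act_word \<tau> (lm r g)"
      using div[OF f] by (auto simp: word_dvd_def elim!: dvdE)
    have "lt r f = const k * act \<tau> (lt r g)"
      unfolding lt_def act_single g(2,3)
      by (simp add: const_def mult_single plus_list_def mult.commute)
    moreover have "lt r g \<in> leading_ideal r G"
      unfolding leading_ideal_def using g(1) assms(3) by (auto intro!: hull_inc)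
    ultimately show ?thesis
      unfolding leading_ideal_def by (simp add: ideal_act_const two_sided_ideal_hull)
  qed
  then have "leading_ideal r I \<subseteq> leading_ideal r G"
    unfolding leading_ideal_def[of r I]
    by (intro hull_minimal) (auto simp: leading_ideal_def two_sided_ideal_hull)
  moreover have "\<exists>g\<in>G. term_dvd (lt r g) (lt r f)" if "f \<in> I - {0}" for f
    using div[OF that] assms(3) that term_dvd_lt_iff[OF r] by (metis DiffE insertI1 subsetD)
  ultimately show ?thesis unfolding strong_groebner_basis_def using assms(2,3) by blast
qed

text \<open>For a nonconstant divisor the bound on its leading coefficient is assumed. A constant divisor
  \<open>c\<close> is traded for a basis element whose leading term divides \<open>gcd(a, c)\<close>; its leading word is
  empty, so it still divides the leading word of \<open>f\<close>.\<close>

lemma exists_divisor_with_lc_dvd: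
  fixes G J :: "('x, 'n::nontriv mod_ring) free_algebra set"
  assumes r: "monomial_well_order r" and J: "two_sided_ideal J"
    and G: "strong_groebner_basis r G (ideal_plus J a)"
    and lc: "\<And>g. g \<in> G - range const \<Longrightarrow> lc r g dvd a"
    and f: "f \<in> J - {0}"
  obtains g where "g \<in> G" "lc r g dvd a" "lc r g dvd lc r f" "word_dvd (lm r g) (lm r f)"
proof -
  have sub: "G \<subseteq> ideal_plus J a - {0}"
    using G by (simp add: strong_groebner_basis_def)
  have div: "\<exists>g\<in>G. lc r g dvd lc r p \<and> word_dvd (lm r g) (lm r p)"
    if p: "p \<in> ideal_plus J a - {0}" for p
  proof -
    obtain g where g: "g \<in> G" "term_dvd (lt r g) (lt r p)"
      using G p unfolding strong_groebner_basis_def by blast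
    then show ?thesis using sub p term_dvd_lt_iff[OF r, of p g] by blast
  qed
  obtain g where g: "g \<in> G" "lc r g dvd lc r f" "word_dvd (lm r g) (lm r f)"
    using div[of f] f subset_ideal_plus by blast
  show ?thesis
  proof (cases "g \<in> range const")
    case False
    then show ?thesis using that g lc by blast
  next
    case True
    then obtain c where c: "g = const c" by blast
    have nz: "c \<noteq> 0" using subsetD[OF sub g(1)] by (auto simp: c const_eq_0_iff)
    obtain d x y where d: "d = a * x + c * y" "d dvd a" "d dvd c" by (rule bezout_mod_ring)
    have d0: "d \<noteq> 0" using d(3) nz by auto
    have "const d \<in> ideal_plus J a"
    proof -
      obtain j p where j: "j \<in> J" "const c = j + const a * p"
        using subsetD[OF sub g(1)] unfolding c ideal_plus_def by blast
      have "(const d :: ('x, 'n mod_ring) free_algebra) = const a * const x + const y * const c"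
        unfolding const_mult d(1) mult.commute[of c y] by (simp add: const_def single_add)
      also have "\<dots> = const y * j + const a * (const x + const y * p)"
        unfolding j(2) distrib_left mult.assoc[symmetric] const_mult mult.commute[of y a]
        by (simp add: algebra_simps)
      finally have "const d = const y * j + const a * (const x + const y * p)" .
      moreover have "const y * j \<in> J"
        using J j(1) unfolding two_sided_ideal_def by (metis mult.right_neutral)
      ultimately show ?thesis unfolding ideal_plus_def by blast
    qed
    then obtain g' where g': "g' \<in> G" "lc r g' dvd d" "word_dvd (lm r g') []"
      using div[of "const d"] d0 by (auto simp: const_eq_0_iff lm_const[OF r d0] lc_const[OF r d0])
    have "lc r g' dvd lc r f"
      using g'(2) d(3) g(2) unfolding c lc_const[OF r nz] by (meson dvd_trans)
    moreover have "word_dvd (lm r g') (lm r f)"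
      using g'(3) by (auto simp: word_dvd_def act_word_def)
    ultimately show ?thesis using that[OF g'(1)] g'(2) d(2) by (meson dvd_trans)
  qed
qed

section \<open>The combined basis\<close>

theorem theorem19:
  fixes m :: int
    and r :: "('x::finite list \<times> 'x list) set"
    and J Ga Gb :: "('x, 'n::nontriv mod_ring) free_algebra set"
    and a b \<rho> \<sigma> :: "'n mod_ring"
  assumes "m \<noteq> 0" and "\<not> is_unit m" and "\<not> prime_elem m"
    and "int CARD('n) = \<bar>m\<bar>"
    and "monomial_well_order r"
    and "two_sided_ideal J"
    and "a * b = 0" and "a * \<rho> + b * \<sigma> = 1"
    and "strong_groebner_basis r Ga (ideal_plus J a)"
    and "strong_groebner_basis r Gb (ideal_plus J b)"
    and "\<And>g. g \<in> Ga - range const \<Longrightarrow> \<not> a dvd lc r g \<and> lc r g dvd a"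
    and "\<And>g. g \<in> Gb - range const \<Longrightarrow> \<not> b dvd lc r g \<and> lc r g dvd b"
    and "\<And>g h. g \<in> Ga \<Longrightarrow> h \<in> Gb \<Longrightarrow> lc r g * lc r h \<noteq> 0"
  shows "strong_groebner_basis r
    {const (a * \<rho> * lc r g) * act \<tau>' h + const (b * \<sigma> * lc r h) * act \<tau> g | g h \<tau> \<tau>'.
       g \<in> Ga \<and> h \<in> Gb \<and> overlap (lm r g) (lm r h) \<tau> \<tau>'} J"
proof -
  note r = assms(5) and J = assms(6)
  define F where "F g h \<tau> \<tau>' = const (a * \<rho> * lc r g) * act \<tau>' h + const (b * \<sigma> * lc r h) * act \<tau> g"
    for g h :: "('x, 'n mod_ring) free_algebra" and \<tau> \<tau>'
  let ?G =
    "{F g h \<tau> \<tau>' | g h \<tau> \<tau>'. g \<in> Ga \<and> h \<in> Gb \<and> overlap (lm r g) (lm r h) \<tau> \<tau>'}"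
  have sub: "Ga \<subseteq> ideal_plus J a - {0}" "Gb \<subseteq> ideal_plus J b - {0}"
    and cnt: "countable Ga" "countable Gb"
    using assms(9,10) by (simp_all add: strong_groebner_basis_def)
  have lead: "lm r (F g h \<tau> \<tau>') = act_word \<tau> (lm r g)"
      "lc r (F g h \<tau> \<tau>') = lc r g * lc r h" "F g h \<tau> \<tau>' \<noteq> 0"
    if "g \<in> Ga" "h \<in> Gb" "overlap (lm r g) (lm r h) \<tau> \<tau>'" for g h \<tau> \<tau>'
  proof -
    have nz: "g \<noteq> 0" "h \<noteq> 0" using that sub by auto
    have w: "act_word \<tau> (lm r g) = act_word \<tau>' (lm r h)" using that(3) by (simp add: overlap_def)
    have "a * \<rho> * lc r g * lc r h + b * \<sigma> * lc r h * lc r g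
        = (a * \<rho> + b * \<sigma>) * (lc r g * lc r h)"
      by (simp only: algebra_simps)
    then have eq: "a * \<rho> * lc r g * lc r h + b * \<sigma> * lc r h * lc r g = lc r g * lc r h"
      by (simp add: assms(8))
    then have "a * \<rho> * lc r g * lc r h + b * \<sigma> * lc r h * lc r g \<noteq> 0"
      using assms(13) that by simp
    note * = leading_data_combination[OF r nz w this]
    show "lm r (F g h \<tau> \<tau>') = act_word \<tau> (lm r g)"
      "lc r (F g h \<tau> \<tau>') = lc r g * lc r h" "F g h \<tau> \<tau>' \<noteq> 0"
      unfolding F_def using * eq by simp_all
  qed
  have "strong_groebner_basis r ?G J"
  proof (rule strong_groebner_basisI[OF r])
    have "?G \<subseteq> (\<lambda>(g, h, \<tau>, \<tau>'). F g h \<tau> \<tau>') ` (Ga \<times> Gb \<times> UNIV \<times> UNIV)"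
      by (auto intro!: image_eqI[where x = "(g, h, \<tau>, \<tau>')" for g h \<tau> \<tau>'])
    then show "countable ?G" by (rule countable_subset) (simp add: cnt)
  next
    have "F g h \<tau> \<tau>' \<in> J" if "g \<in> Ga" "h \<in> Gb" for g h \<tau> \<tau>'
    proof -
      have "a * \<rho> * lc r g * b = a * b * (\<rho> * lc r g)"
        "b * \<sigma> * lc r h * a = a * b * (\<sigma> * lc r h)"
        by (simp_all only: ac_simps)
      then have annih: "a * \<rho> * lc r g * b = 0" "b * \<sigma> * lc r h * a = 0"
        by (simp_all only: assms(7) mult_zero_left)
      have "h \<in> ideal_plus J b" "g \<in> ideal_plus J a" using that sub by blast+
      then have "const (a * \<rho> * lc r g) * act \<tau>' h \<in> J"
        "const (b * \<sigma> * lc r h) * act \<tau> g \<in> J"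
        using annihilator_mult_ideal_plus[OF J] annih by simp_all
      then show ?thesis unfolding F_def using J by (simp add: two_sided_ideal_def)
    qed
    then show "?G \<subseteq> J - {0}" using lead(3) by auto
  next
    fix f assume f: "f \<in> J - {0}"
    obtain g where g: "g \<in> Ga" "lc r g dvd a" "lc r g dvd lc r f" "word_dvd (lm r g) (lm r f)"
      using exists_divisor_with_lc_dvd[OF r J assms(9) _ f] assms(11) by blast
    obtain h where h: "h \<in> Gb" "lc r h dvd b" "lc r h dvd lc r f" "word_dvd (lm r h) (lm r f)"
      using exists_divisor_with_lc_dvd[OF r J assms(10) _ f] assms(12) by blast
    obtain \<tau> \<tau>' where \<tau>: "overlap (lm r g) (lm r h) \<tau> \<tau>'"
        "word_dvd (act_word \<tau> (lm r g)) (lm r f)"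
      using overlap_of_common_multiple[OF g(4) h(4)] by blast
    have "lc r g * lc r h dvd lc r f"
      by (rule mult_dvd_of_divides_comaximal[OF g(2) h(2) assms(8) g(3) h(3)])
    then have "lc r (F g h \<tau> \<tau>') dvd lc r f \<and> word_dvd (lm r (F g h \<tau> \<tau>')) (lm r f)"
      unfolding lead(1,2)[OF g(1) h(1) \<tau>(1)] using \<tau>(2) by blast
    moreover have "F g h \<tau> \<tau>' \<in> ?G" using g(1) h(1) \<tau>(1) by blast
    ultimately show "\<exists>p\<in>?G. lc r p dvd lc r f \<and> word_dvd (lm r p) (lm r f)" by (rule bexI)
  qed
  then show ?thesis unfolding F_def .
qed

end
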